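(* For every even integer $n \geq 8$ there exists a nut graph $G$ of order $n$ with $o_v(G) = 1$ and $o_e(G) = 2$.
   Context: A nut graph is a simple connected graph $G$ whose adjacency matrix has one-dimensional kernel spanned by a vector with no zero entry. $o_v(G)$ and $o_e(G)$ denote the numbers of orbits of the full automorphism group $\mathrm{Aut}(G)$ on vertices and on edges, respectively. *)

theory Defs
  imports
    "Graph_Theory.Graph_Theory"
    "Jordan_Normal_Form.Matrix_Kernel"
    "HOL-Algebra.Group_Action"
    "HOL-Combinatorics.Permutations"
begin

text \<open>
  A finite simple graph is a \<open>pair_graph\<close>: a finite, symmetric, loop-free set of arcs given
  as pairs, so that an edge joining \<open>u\<close> and \<open>v\<close> is represented by the two arcs
  \<open>(u, v)\<close> and \<open>(v, u)\<close>.
\<close>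

definition edges :: "'a pair_pre_digraph \<Rightarrow> 'a set set" where
  "edges G = (\<lambda>(u, v). {u, v}) ` parcs G"

text \<open>
  Rows and columns are indexed by the vertices in increasing order; the order is only used to
  obtain a matrix with numbered rows and columns.
\<close>

definition adjacency_matrix :: "'a::linorder pair_pre_digraph \<Rightarrow> real mat" where
  "adjacency_matrix G =
    (let vs = sorted_list_of_set (pverts G); n = card (pverts G)
     in mat n n (\<lambda>(i, j). if (vs ! i, vs ! j) \<in> parcs G then 1 else 0))"

definition nut_graph :: "'a::linorder pair_pre_digraph \<Rightarrow> bool" where
  "nut_graph G \<longleftrightarrow>
    pair_graph G \<and>
    Digraph_Component.connected (with_proj G) \<and>
    kernel_dim (adjacency_matrix G) = 1 \<and>
    (\<exists>x \<in> carrier_vec (card (pverts G)).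
      mat_kernel (adjacency_matrix G) =
        LinearCombinations.module.span class_ring (module_vec TYPE(real) (card (pverts G))) {x} \<and>
      (\<forall>i < card (pverts G). x $ i \<noteq> 0))"

definition automorphism_group :: "'a pair_pre_digraph \<Rightarrow> ('a \<Rightarrow> 'a) monoid" where
  "automorphism_group G =
    \<lparr>carrier = {p. p permutes pverts G \<and>
        (\<forall>u \<in> pverts G. \<forall>v \<in> pverts G. (p u, p v) \<in> parcs G \<longleftrightarrow> (u, v) \<in> parcs G)},
     mult = (\<circ>), one = id\<rparr>"

definition num_vertex_orbits :: "'a pair_pre_digraph \<Rightarrow> nat" where
  "num_vertex_orbits G = card (orbits (automorphism_group G) (pverts G) (\<lambda>p v. p v))"

definition num_edge_orbits :: "'a pair_pre_digraph \<Rightarrow> nat" where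
  "num_edge_orbits G = card (orbits (automorphism_group G) (edges G) (\<lambda>p e. p ` e))"

lemma group_automorphism_group: "Group.group (automorphism_group G)"
proof (rule Group.groupI)
  fix p assume p: "p \<in> carrier (automorphism_group G)"
  let ?q = "inv_into UNIV p"
  have perm: "p permutes pverts G"
    and arcs: "\<And>u v. u \<in> pverts G \<Longrightarrow> v \<in> pverts G \<Longrightarrow>
      (p u, p v) \<in> parcs G \<longleftrightarrow> (u, v) \<in> parcs G"
    using p by (simp_all add: automorphism_group_def)
  have perm_q: "?q permutes pverts G" using perm by (rule permutes_inv)
  have "(?q u, ?q v) \<in> parcs G \<longleftrightarrow> (u, v) \<in> parcs G"
    if "u \<in> pverts G" "v \<in> pverts G" for u v
    using arcs[of "?q u" "?q v"] that
    by (simp only: permutes_in_image[OF perm_q] permutes_inverses(1)[OF perm])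
  with perm_q have "?q \<in> carrier (automorphism_group G)"
    by (simp add: automorphism_group_def)
  moreover have "?q \<circ> p = id" using perm by (rule permutes_inv_o)
  ultimately show "\<exists>q \<in> carrier (automorphism_group G).
      q \<otimes>\<^bsub>automorphism_group G\<^esub> p = \<one>\<^bsub>automorphism_group G\<^esub>"
    by (intro bexI[of _ ?q]) (simp_all add: automorphism_group_def)
next
  fix p q assume "p \<in> carrier (automorphism_group G)" "q \<in> carrier (automorphism_group G)"
  then show "p \<otimes>\<^bsub>automorphism_group G\<^esub> q \<in> carrier (automorphism_group G)"
    by (simp add: automorphism_group_def permutes_compose permutes_in_image)
qed (simp_all add: automorphism_group_def permutes_id comp_assoc)

end

theory Submission
  imports Defs "HOL-Number_Theory.Cong"
begin

text \<open>
  Take the circulant graph on \<open>\<int>/n\<close> with connection set \<open>{\<plusminus>k, \<plusminus>(k + 1)}\<close>, where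
  \<open>k = n div 4 - 1\<close>. Its adjacency operator is, up to a shift, \<open>(T + 1) (T^(2k+1) + 1)\<close> with
  \<open>T\<close> the cyclic shift. Since \<open>2k + 1\<close> is coprime to the even number \<open>n\<close>, its kernel is spanned
  by the alternating vector. Rotations act transitively on the vertices and on each of the two
  classes of edges \<open>{u, u + k}\<close> and \<open>{u, u + k + 1}\<close>. The product of the entries of the kernel
  vector at the ends of an edge is invariant under automorphisms and differs between the two
  classes, so they are not merged.
\<close>

text \<open>Adding the shift on either side of a congruence encodes the signs in the connection set
  without subtraction on \<open>nat\<close>, and makes the arc relation visibly symmetric.\<close>

definition consecutive_circulant :: "nat \<Rightarrow> nat \<Rightarrow> nat pair_pre_digraph" where
  "consecutive_circulant n k =
    \<lparr>pverts = {..<n},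
     parcs = {(u, v). u < n \<and> v < n \<and>
       (\<exists>s \<in> {k, k + 1}. [v = u + s] (mod n) \<or> [u = v + s] (mod n))}\<rparr>"

section \<open>One-dimensional kernels, adjacency matrices and a periodic recurrence\<close>

lemma span_singleton_vec:
  fixes x :: "real vec"
  assumes x: "x \<in> carrier_vec n"
  shows "LinearCombinations.module.span class_ring (module_vec TYPE(real) n) {x} =
    range (\<lambda>c. c \<cdot>\<^sub>v x)"
proof -
  interpret vec_space "TYPE(real)" n .
  have "lincomb a {x} = a x \<cdot>\<^sub>v x" for a
    using x by (simp add: lincomb_def)
  then have "span {x} = {a x \<cdot>\<^sub>v x | a. True}"
    using x by (simp add: finite_span class_ring_simps)
  also have "\<dots> = range (\<lambda>c. c \<cdot>\<^sub>v x)"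
    by auto
  finally show ?thesis .
qed

lemma kernel_dim_eq_1:
  fixes A :: "real mat"
  assumes A: "A \<in> carrier_mat m n" and x: "x \<in> carrier_vec n" "x \<noteq> 0\<^sub>v n"
    and ker: "mat_kernel A = range (\<lambda>c. c \<cdot>\<^sub>v x)"
  shows "kernel_dim A = 1"
proof -
  interpret kernel m n A by unfold_locales (rule A)
  have x_ker: "x \<in> mat_kernel A"
    unfolding ker by (rule image_eqI[of _ _ 1]) simp_all
  \<comment> \<open>The dimension is that of the kernel as a space of its own, while
    \<open>ker\<close> speaks of multiples in the ambient space; \<open>span_same\<close> identifies
    the two spans.\<close>
  have "span {x} = NC.span {x}"
    using x_ker by (intro span_same) simp
  then have "span {x} = mat_kernel A"
    by (simp add: span_singleton_vec[OF x(1)] ker)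
  then have "dim = 1"
    using x x_ker by (intro Ker.dim1I) simp_all
  then show ?thesis using A by (simp add: kernel_dim_def)
qed

lemma adjacency_matrix_initial_segment:
  assumes "pverts G = {..<n}"
  shows "adjacency_matrix G = mat n n (\<lambda>(i, j). if (i, j) \<in> parcs G then 1 else 0)"
proof -
  have "sorted_list_of_set {..<n} = [0..<n]"
    by (simp add: lessThan_atLeast0)
  then show ?thesis
    unfolding adjacency_matrix_def Let_def assms by (intro eq_matI) simp_all
qed

text \<open>Eliminates matrices: what remains is the condition on neighbour sums that
  \<open>neighbour_sum_zero_iff\<close> solves for the circulant graph.\<close>

lemma mat_kernel_adjacency_matrix:
  assumes V: "pverts G = {..<n}" and wf: "parcs G \<subseteq> {..<n} \<times> {..<n}"
  shows "mat_kernel (adjacency_matrix G) =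
    {x \<in> carrier_vec n. \<forall>u<n. (\<Sum>v | (u, v) \<in> parcs G. x $ v) = 0}"
proof -
  have "(adjacency_matrix G *\<^sub>v x) $ u = (\<Sum>v | (u, v) \<in> parcs G. x $ v)"
    if "x \<in> carrier_vec n" "u < n" for x u
  proof -
    have "(adjacency_matrix G *\<^sub>v x) $ u =
        (\<Sum>v = 0..<n. (if (u, v) \<in> parcs G then 1 else 0) * x $ v)"
      using that by (simp add: adjacency_matrix_initial_segment[OF V] scalar_prod_def)
    also have "\<dots> = (\<Sum>v = 0..<n. if (u, v) \<in> parcs G then x $ v else 0)"
      by (intro sum.cong) auto
    also have "\<dots> = (\<Sum>v \<in> {v \<in> {0..<n}. (u, v) \<in> parcs G}. x $ v)"
      by (rule sum.inter_filter[symmetric]) simp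
    also have "{v \<in> {0..<n}. (u, v) \<in> parcs G} = {v. (u, v) \<in> parcs G}"
      using wf by auto
    finally show ?thesis .
  qed
  note entry = this
  let ?A = "adjacency_matrix G"
  have A: "?A \<in> carrier_mat n n"
    by (simp add: adjacency_matrix_initial_segment[OF V])
  have "?A *\<^sub>v x = 0\<^sub>v n \<longleftrightarrow> (\<forall>u<n. (\<Sum>v | (u, v) \<in> parcs G. x $ v) = 0)"
    if x: "x \<in> carrier_vec n" for x
  proof
    assume "?A *\<^sub>v x = 0\<^sub>v n"
    then show "\<forall>u<n. (\<Sum>v | (u, v) \<in> parcs G. x $ v) = 0"
      by (metis entry[OF x] index_zero_vec(1))
  next
    assume *: "\<forall>u<n. (\<Sum>v | (u, v) \<in> parcs G. x $ v) = 0"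
    show "?A *\<^sub>v x = 0\<^sub>v n"
    proof (rule eq_vecI)
      fix u assume "u < dim_vec (0\<^sub>v n :: real vec)"
      then have "u < n" by simp
      then show "(?A *\<^sub>v x) $ u = 0\<^sub>v n $ u"
        using * by (simp only: entry[OF x] index_zero_vec)
    qed (use A in simp)
  qed
  then show ?thesis unfolding mat_kernel[OF A] by blast
qed

text \<open>In terms of the shift \<open>T\<close>, the hypothesis is \<open>(T + 1) (T^(2k+1) + 1) x = 0\<close>.\<close>

lemma periodic_alternating:
  fixes x :: "nat \<Rightarrow> real"
  assumes per: "\<And>i. x (i + n) = x i" and n: "even n" "n > 0"
    and cop: "coprime (2 * k + 1) n"
    and eq: "\<And>i. x i + x (i + 1) + x (i + 2 * k + 1) + x (i + 2 * k + 2) = 0"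
  shows "x i = (- 1) ^ i * x 0"
proof -
  \<comment> \<open>Here \<open>y\<close> is (T + 1) x, so the hypothesis \<open>eq\<close> says
    that shifting \<open>y\<close> by \<open>2 * k + 1\<close> negates it.\<close>
  define y where "y i = x i + x (i + 1)" for i
  have per_x: "x (i + n * t) = x i" for i t
  proof (induction t)
    case (Suc t)
    then show ?case using per[of "i + n * t"] by (simp add: algebra_simps)
  qed simp
  then have per_y: "y (i + n * t) = y i" for i t
    using per_x[of i t] per_x[of "i + 1" t] by (simp add: y_def add_ac)
  have y_mult: "y (i + j * (2 * k + 1)) = (- 1) ^ j * y i" for i j
  proof (induction j)
    case (Suc j)
    have "y (l + (2 * k + 1)) = - y l" for l
      using eq[of l] by (simp add: y_def algebra_simps)
    from this[of "i + j * (2 * k + 1)"] Suc show ?case by (simp add: algebra_simps)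
  qed simp
  \<comment> \<open>Shifting \<open>j\<close> times by \<open>2 * k + 1\<close> amounts to a single
    shift by 1 modulo \<open>n\<close>. As \<open>n\<close> is even, \<open>j\<close> must be odd,
    so the accumulated sign is -1.\<close>
  obtain j where j: "[(2 * k + 1) * j = Suc 0] (mod n)"
    using cong_solve_coprime_nat[OF cop] by auto
  from j have "[(2 * k + 1) * j = Suc 0] (mod 2)"
    using n(1) by (metis cong_dvd_modulus_nat)
  then have "odd ((2 * k + 1) * j)"
    by (simp add: cong_def mod2_eq_if split: if_splits)
  then have "odd j" by simp
  \<comment> \<open>This bound lets the congruence become an equation with a natural multiple of
    \<open>n\<close>.\<close>
  then have "(2 * k + 1) * j \<ge> Suc 0" by (cases j) auto
  with j obtain t where t: "(2 * k + 1) * j = Suc 0 + n * t"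
    by (metis cong_le_nat mult.commute add.commute)
  have y_Suc: "y (i + 1) = - y i" for i
    using y_mult[of i j] per_y[of "i + 1" t] t \<open>odd j\<close> by (simp add: algebra_simps)
  then have y: "y i = (- 1) ^ i * y 0" for i
    by (induction i) simp_all
  \<comment> \<open>General solution of the first-order recurrence x(i + 1) = y(i) - x(i) with
    alternating \<open>y\<close>. Its linear term is incompatible with the period
    \<open>n > 0\<close>, which forces \<open>y 0 = 0\<close>.\<close>
  have x: "x i = (- 1) ^ i * (x 0 - real i * y 0)" for i
  proof (induction i)
    case (Suc i)
    then show ?case using y[of i] by (simp add: y_def algebra_simps)
  qed simp
  from x[of n] per[of 0] n have "y 0 = 0" by simp
  with x[of i] show ?thesis by simp
qed

section \<open>The circulant graph: neighbourhoods, kernel and the nut property\<close>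

context
  fixes n k :: nat
  assumes even: "even n" and k: "k \<ge> 1" "2 * k + 2 < n" and cop: "coprime (2 * k + 1) n"
begin

abbreviation (input) "\<Gamma> \<equiv> consecutive_circulant n k"

lemma pverts_\<Gamma>: "pverts \<Gamma> = {..<n}"
  by (simp add: consecutive_circulant_def)

lemma parcs_\<Gamma>: "(u, v) \<in> parcs \<Gamma> \<longleftrightarrow> u < n \<and> v < n \<and>
    (\<exists>s \<in> {k, k + 1}. [v = u + s] (mod n) \<or> [u = v + s] (mod n))"
  by (simp add: consecutive_circulant_def)

lemma parcs_\<Gamma>_sym: "(u, v) \<in> parcs \<Gamma> \<Longrightarrow> (v, u) \<in> parcs \<Gamma>"
  by (auto simp: parcs_\<Gamma>)

lemma parcs_\<Gamma>_subset: "parcs \<Gamma> \<subseteq> {..<n} \<times> {..<n}"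
  by (auto simp: consecutive_circulant_def)

text \<open>Centring at \<open>i + k + 1\<close> keeps all four offsets nonnegative and gives the
  neighbour sum the shape of the recurrence in \<open>periodic_alternating\<close>.\<close>

lemma neighbours:
  "{v. ((i + k + 1) mod n, v) \<in> parcs \<Gamma>} =
    {i mod n, (i + 1) mod n, (i + 2 * k + 1) mod n, (i + 2 * k + 2) mod n}"
proof -
  let ?u = "(i + k + 1) mod n"
  have n0: "n > 0" using k by simp
  have fwd: "[v = ?u + s] (mod n) \<longleftrightarrow> v = (i + k + 1 + s) mod n" if "v < n" for v s
    using that by (simp add: cong_def mod_add_left_eq)
  have bwd: "[?u = v + s] (mod n) \<longleftrightarrow> v = (i + k + 1 - s) mod n"
    if "v < n" "s \<le> k + 1" for v s
  proof -
    have "[?u = v + s] (mod n) \<longleftrightarrow> [(i + k + 1 - s) + s = v + s] (mod n)"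
      using that by (simp add: cong_def)
    also have "\<dots> \<longleftrightarrow> [i + k + 1 - s = v] (mod n)"
      by (rule cong_add_rcancel_nat)
    finally show ?thesis using that by (auto simp: cong_def)
  qed
  have "(?u, v) \<in> parcs \<Gamma> \<longleftrightarrow> v \<in> {i mod n, (i + 1) mod n, (i + 2 * k + 1) mod n,
      (i + 2 * k + 2) mod n}" for v
  proof (cases "v < n")
    case True
    have s: "[v = ?u + k] (mod n) \<longleftrightarrow> v = (i + 2 * k + 1) mod n"
      "[v = ?u + (k + 1)] (mod n) \<longleftrightarrow> v = (i + 2 * k + 2) mod n"
      "[?u = v + k] (mod n) \<longleftrightarrow> v = (i + 1) mod n"
      "[?u = v + (k + 1)] (mod n) \<longleftrightarrow> v = i mod n"
      unfolding fwd[OF True] using bwd[OF True, of k] bwd[OF True, of "k + 1"]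
      by (simp_all add: mult_2 add_ac)
    have "?u < n" using n0 by simp
    then show ?thesis
      unfolding parcs_\<Gamma> bex_simps s using True by blast
  next
    case False
    then show ?thesis using n0 by (auto simp: parcs_\<Gamma>)
  qed
  then show ?thesis by blast
qed

lemma sum_neighbours:
  fixes x :: "nat \<Rightarrow> real"
  shows "(\<Sum>v | ((i + k + 1) mod n, v) \<in> parcs \<Gamma>. x v) =
    x (i mod n) + x ((i + 1) mod n) + x ((i + 2 * k + 1) mod n) + x ((i + 2 * k + 2) mod n)"
proof -
  define c where "c j = (i + j) mod n" for j
  \<comment> \<open>The offsets 0, 1, \<open>2 * k + 1\<close>, \<open>2 * k + 2\<close> are
    distinct because \<open>k \<ge> 1\<close>, and stay distinct modulo \<open>n\<close> because
    \<open>2 * k + 2 < n\<close>. Thus no two summands collapse.\<close>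
  have neq: "c a \<noteq> c b" if "a < b" "b < n" for a b
  proof
    assume "c a = c b"
    then have "[a = b] (mod n)" by (metis c_def cong_def cong_add_lcancel_nat)
    with that show False by (simp add: cong_def)
  qed
  have "c 0 \<noteq> c 1" "c 0 \<noteq> c (2 * k + 1)" "c 0 \<noteq> c (2 * k + 2)"
    "c 1 \<noteq> c (2 * k + 1)" "c 1 \<noteq> c (2 * k + 2)" "c (2 * k + 1) \<noteq> c (2 * k + 2)"
    using k by (intro neq; linarith)+
  then have "sum x {c 0, c 1, c (2 * k + 1), c (2 * k + 2)} =
      x (c 0) + x (c 1) + x (c (2 * k + 1)) + x (c (2 * k + 2))"
    by (simp add: add.assoc)
  then show ?thesis
    unfolding neighbours by (simp only: c_def add.assoc add.right_neutral)
qed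

text \<open>Stated for functions on \<open>nat\<close> so that it serves both the entries of a
  vector and the alternating function composed with an automorphism.\<close>

lemma neighbour_sum_zero_iff:
  fixes x :: "nat \<Rightarrow> real"
  shows "(\<forall>u<n. (\<Sum>v | (u, v) \<in> parcs \<Gamma>. x v) = 0) \<longleftrightarrow>
    (\<forall>i<n. x i = (- 1) ^ i * x 0)" (is "?L \<longleftrightarrow> ?R")
proof
  have n0: "n > 0" using k by simp
  \<comment> \<open>Periodic extension of the values at the vertices to all of
    \<open>nat\<close>.\<close>
  define x' where "x' i = x (i mod n)" for i
  assume L: ?L
  have "x' i = (- 1) ^ i * x' 0" for i
  proof (rule periodic_alternating[where n = n and k = k])
    fix i
    show "x' (i + n) = x' i" by (simp add: x'_def)
    show "x' i + x' (i + 1) + x' (i + 2 * k + 1) + x' (i + 2 * k + 2) = 0"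
      using L n0 sum_neighbours[where x = x and i = i] by (simp add: x'_def)
  qed (use even n0 cop in simp_all)
  then have "x' i = (- 1) ^ i * x' 0" for i by blast
  then show ?R by (metis x'_def mod_less n0)
next
  have n0: "n > 0" using k by simp
  assume R: ?R
  \<comment> \<open>Evenness of \<open>n\<close> makes the alternating signs consistent around the
    cycle.\<close>
  have parity: "(- 1) ^ (i mod n) = (- 1 :: real) ^ i" for i
    using even by (metis dvd_mod_iff minus_one_power_iff)
  have val: "x (i mod n) = (- 1) ^ i * x 0" for i
    using R[rule_format, of "i mod n"] n0 by (simp add: parity)
  show ?L
  proof (intro allI impI)
    fix u assume u: "u < n"
    \<comment> \<open>The index u - (k + 1), with \<open>n\<close> added to avoid truncated
      subtraction.\<close>
    define i where "i = u + n - (k + 1)"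
    have "i + k + 1 = u + n" using k by (simp add: i_def)
    then have i: "u = (i + k + 1) mod n" using u by simp
    show "(\<Sum>v | (u, v) \<in> parcs \<Gamma>. x v) = 0"
      unfolding i sum_neighbours val by (simp add: power_add)
  qed
qed

lemma pair_graph_\<Gamma>: "pair_graph \<Gamma>"
proof
  show "finite (parcs \<Gamma>)"
    by (rule finite_subset[OF parcs_\<Gamma>_subset]) simp
  show "finite (pverts \<Gamma>)" by (simp add: pverts_\<Gamma>)
  show "symmetric \<Gamma>"
    by (auto simp: symmetric_def sym_def intro: parcs_\<Gamma>_sym)
next
  fix e assume e: "e \<in> parcs \<Gamma>"
  obtain u v where uv: "e = (u, v)" by (cases e)
  show "fst e \<in> pverts \<Gamma>" "snd e \<in> pverts \<Gamma>"
    using e by (auto simp: uv parcs_\<Gamma> pverts_\<Gamma>)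
  have "\<not> [u = u + s] (mod n)" if "s \<in> {k, k + 1}" for s
  proof
    assume "[u = u + s] (mod n)"
    then have "[0 = s] (mod n)" by (metis add.right_neutral cong_add_lcancel_nat)
    moreover have "s < n" "s > 0" using that k by auto
    ultimately show False by (simp add: cong_def)
  qed
  from this[of k] this[of "k + 1"] show "fst e \<noteq> snd e"
    using e by (auto simp: uv parcs_\<Gamma>)
qed

lemma connected_\<Gamma>: "Digraph_Component.connected (with_proj \<Gamma>)"
proof -
  interpret pair_graph \<Gamma> by (rule pair_graph_\<Gamma>)
  have n0: "n > 0" using k by simp
  \<comment> \<open>Consecutive vertices \<open>u\<close> and \<open>Suc u\<close> have the common
    neighbour \<open>u + k + 1\<close> modulo \<open>n\<close>, so a path of length two joins
    them.\<close>
  have step: "u \<rightarrow>\<^sup>*\<^bsub>with_proj \<Gamma>\<^esub> Suc u" if u: "Suc u < n" for u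
  proof -
    let ?w = "(u + k + 1) mod n"
    have "u \<in> {v. (?w, v) \<in> parcs \<Gamma>}" "Suc u \<in> {v. (?w, v) \<in> parcs \<Gamma>}"
      unfolding neighbours using u by simp_all
    then have "(u, ?w) \<in> parcs \<Gamma>" "(?w, Suc u) \<in> parcs \<Gamma>"
      by (auto intro: parcs_\<Gamma>_sym)
    from this[THEN reachable_adjI] show ?thesis by (rule reachable_trans)
  qed
  have from0: "0 \<rightarrow>\<^sup>*\<^bsub>with_proj \<Gamma>\<^esub> u" if "u < n" for u
    using that
  proof (induction u)
    case 0
    then show ?case by (intro reachable_refl) (simp add: pverts_\<Gamma>)
  next
    case (Suc u)
    then show ?case using step[of u] by (auto intro: reachable_trans)
  qed
  have "strongly_connected (with_proj \<Gamma>)"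
  proof (rule strongly_connectedI)
    show "verts (with_proj \<Gamma>) \<noteq> {}" using n0 by (auto simp: pverts_\<Gamma>)
    fix u v assume "u \<in> verts (with_proj \<Gamma>)" "v \<in> verts (with_proj \<Gamma>)"
    then have "0 \<rightarrow>\<^sup>*\<^bsub>with_proj \<Gamma>\<^esub> u" and v: "0 \<rightarrow>\<^sup>*\<^bsub>with_proj \<Gamma>\<^esub> v"
      by (simp_all add: from0 pverts_\<Gamma>)
    from symmetric_reachable'[OF this(1)] v show "u \<rightarrow>\<^sup>*\<^bsub>with_proj \<Gamma>\<^esub> v"
      by (rule reachable_trans)
  qed
  then show ?thesis
    unfolding connected_def strongly_connected_def
    using reachable_mk_symmetricI by (auto simp: pverts_\<Gamma>)
qed

lemma nut_graph_\<Gamma>: "nut_graph \<Gamma>"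
proof -
  let ?x = "vec n (\<lambda>i. (- 1) ^ i) :: real vec"
  have n0: "n > 0" using k by simp
  have A: "adjacency_matrix \<Gamma> \<in> carrier_mat n n"
    by (simp add: adjacency_matrix_initial_segment[OF pverts_\<Gamma>])
  have ker: "mat_kernel (adjacency_matrix \<Gamma>) = range (\<lambda>c. c \<cdot>\<^sub>v ?x)"
  proof -
    have "mat_kernel (adjacency_matrix \<Gamma>) =
        {x \<in> carrier_vec n. \<forall>i<n. x $ i = (- 1) ^ i * x $ 0}"
      by (simp add: mat_kernel_adjacency_matrix[OF pverts_\<Gamma> parcs_\<Gamma>_subset]
          neighbour_sum_zero_iff)
    also have "\<dots> = range (\<lambda>c. c \<cdot>\<^sub>v ?x)"
    proof (intro equalityI subsetI)
      fix x :: "real vec"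
      assume x: "x \<in> {x \<in> carrier_vec n. \<forall>i<n. x $ i = (- 1) ^ i * x $ 0}"
      have "x = x $ 0 \<cdot>\<^sub>v ?x"
      proof (rule eq_vecI)
        fix i assume "i < dim_vec (x $ 0 \<cdot>\<^sub>v ?x)"
        then have "i < n" by simp
        moreover have "x $ i = (- 1) ^ i * x $ 0" using x calculation by blast
        ultimately show "x $ i = (x $ 0 \<cdot>\<^sub>v ?x) $ i" by simp
      qed (use x in simp)
      then show "x \<in> range (\<lambda>c. c \<cdot>\<^sub>v ?x)" by blast
    qed (use n0 in auto)
    finally show ?thesis .
  qed
  have "?x $ 0 \<noteq> 0" using n0 by simp
  then have "?x \<noteq> 0\<^sub>v n" using n0 by (metis index_zero_vec(1))
  then have "kernel_dim (adjacency_matrix \<Gamma>) = 1"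
    using kernel_dim_eq_1[OF A _ _ ker] by simp
  moreover have "mat_kernel (adjacency_matrix \<Gamma>) =
      LinearCombinations.module.span class_ring (module_vec TYPE(real) n) {?x}"
    by (simp add: ker span_singleton_vec)
  ultimately show ?thesis
    unfolding nut_graph_def
    by (auto simp: pair_graph_\<Gamma> connected_\<Gamma> pverts_\<Gamma> intro!: bexI[of _ ?x])
qed

section \<open>Automorphisms and vertex orbits\<close>

text \<open>The identity outside the vertex set is what \<open>permutes\<close> demands.\<close>

definition rotation :: "nat \<Rightarrow> nat \<Rightarrow> nat" where
  "rotation t v = (if v < n then (v + t) mod n else v)"

lemma rotation_automorphism: "rotation t \<in> carrier (automorphism_group \<Gamma>)"
proof -
  have n0: "n > 0" using k by simp
  have rot_cong: "[rotation t v = v + t] (mod n)" if "v < n" for v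
    using that by (simp add: rotation_def cong_def)
  have rot_less: "rotation t v < n \<longleftrightarrow> v < n" for v
    using n0 by (simp add: rotation_def)
  have shift: "[rotation t v = rotation t u + s] (mod n) \<longleftrightarrow> [v = u + s] (mod n)"
    if "u < n" "v < n" for u v s
  proof -
    have "[rotation t u + s = u + s + t] (mod n)"
      using cong_add[OF rot_cong[OF that(1)] cong_refl[of s n]] by (simp add: add_ac)
    then have "[rotation t v = rotation t u + s] (mod n) \<longleftrightarrow> [v + t = u + s + t] (mod n)"
      using rot_cong[OF that(2)] by (simp add: cong_def)
    then show ?thesis by (simp only: cong_add_rcancel_nat)
  qed
  \<comment> \<open>Injectivity is the case \<open>s = 0\<close> of \<open>shift\<close>; finiteness
    then yields surjectivity.\<close>
  have "inj_on (rotation t) {..<n}"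
  proof (rule inj_onI)
    fix u v assume "u \<in> {..<n}" "v \<in> {..<n}" "rotation t u = rotation t v"
    then show "u = v" using shift[of v u 0] by (simp add: cong_def)
  qed
  moreover have "rotation t ` {..<n} \<subseteq> {..<n}" using rot_less by auto
  ultimately have "bij_betw (rotation t) {..<n} {..<n}"
    by (simp add: bij_betw_def endo_inj_surj)
  then have "rotation t permutes {..<n}"
    by (rule bij_imp_permutes) (simp add: rotation_def)
  moreover have "(rotation t u, rotation t v) \<in> parcs \<Gamma> \<longleftrightarrow> (u, v) \<in> parcs \<Gamma>"
    if "u < n" "v < n" for u v
    unfolding parcs_\<Gamma> rot_less shift[OF that] shift[OF that(2,1)] ..
  ultimately show ?thesis
    by (simp add: automorphism_group_def pverts_\<Gamma>)
qed

lemma num_vertex_orbits_\<Gamma>: "num_vertex_orbits \<Gamma> = 1"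
proof -
  have "orbit (automorphism_group \<Gamma>) (\<lambda>p v. p v) u = {..<n}" if u: "u < n" for u
  proof (intro equalityI subsetI)
    fix v assume "v \<in> {..<n}"
    then have "rotation (v + n - u) u = v" using u by (simp add: rotation_def)
    then show "v \<in> orbit (automorphism_group \<Gamma>) (\<lambda>p v. p v) u"
      unfolding orbit_def
      by (intro CollectI exI[of _ "rotation (v + n - u)"]) (simp add: rotation_automorphism)
  next
    fix v assume "v \<in> orbit (automorphism_group \<Gamma>) (\<lambda>p v. p v) u"
    then obtain p where "p permutes {..<n}" "v = p u"
      by (auto simp: orbit_def automorphism_group_def pverts_\<Gamma>)
    then show "v \<in> {..<n}" using u permutes_in_image by force
  qed
  then have "orbits (automorphism_group \<Gamma>) (pverts \<Gamma>) (\<lambda>p v. p v) = {{..<n}}"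
    using k by (force simp: orbits_def pverts_\<Gamma>)
  then show ?thesis by (simp add: num_vertex_orbits_def)
qed

text \<open>An automorphism maps the alternating kernel vector to plus or minus itself, so it
  preserves the product of the entries at the two ends of an edge.\<close>

lemma automorphism_parity:
  assumes p: "p \<in> carrier (automorphism_group \<Gamma>)" and uv: "u < n" "v < n"
  shows "even (p u + p v) \<longleftrightarrow> even (u + v)"
proof -
  have perm: "p permutes {..<n}"
    and arcs: "\<And>u v. u < n \<Longrightarrow> v < n \<Longrightarrow> (p u, p v) \<in> parcs \<Gamma> \<longleftrightarrow> (u, v) \<in> parcs \<Gamma>"
    using p by (auto simp: automorphism_group_def pverts_\<Gamma>)
  have less: "p u < n \<longleftrightarrow> u < n" for u
    using permutes_in_image[OF perm] by simp
  \<comment> \<open>The alternating function composed with \<open>p\<close> again has vanishing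
    neighbour sums, since \<open>p\<close> maps the neighbourhood of \<open>u\<close> bijectively
    onto that of \<open>p u\<close>.\<close>
  have "(\<Sum>v | (u, v) \<in> parcs \<Gamma>. (- 1 :: real) ^ p v) = 0" if u: "u < n" for u
  proof -
    have "(\<Sum>v | (u, v) \<in> parcs \<Gamma>. (- 1 :: real) ^ p v) =
        (\<Sum>w | (p u, w) \<in> parcs \<Gamma>. (- 1) ^ w)"
    proof (rule sum.reindex_cong[symmetric])
      show "inj_on p {v. (u, v) \<in> parcs \<Gamma>}"
        using permutes_inj[OF perm] by (rule inj_on_subset) simp
      show "{w. (p u, w) \<in> parcs \<Gamma>} = p ` {v. (u, v) \<in> parcs \<Gamma>}"
      proof (intro equalityI subsetI)
        fix w assume "w \<in> {w. (p u, w) \<in> parcs \<Gamma>}"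
        moreover obtain v where "w = p v" using permutes_surj[OF perm] by blast
        moreover have "v < n" using calculation less by (simp add: parcs_\<Gamma>)
        ultimately show "w \<in> p ` {v. (u, v) \<in> parcs \<Gamma>}" using arcs[OF u, of v] by auto
      next
        fix w assume "w \<in> p ` {v. (u, v) \<in> parcs \<Gamma>}"
        then obtain v where "w = p v" "(u, v) \<in> parcs \<Gamma>" by auto
        moreover have "v < n" using calculation by (simp add: parcs_\<Gamma>)
        ultimately show "w \<in> {w. (p u, w) \<in> parcs \<Gamma>}" using arcs[OF u] by simp
      qed
    qed simp
    also have "\<dots> = 0"
      using neighbour_sum_zero_iff[of "\<lambda>i. (- 1) ^ i"] less u by simp
    finally show ?thesis .
  qed
  then have "\<forall>i<n. (- 1 :: real) ^ p i = (- 1) ^ i * (- 1) ^ p 0"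
    by (intro iffD1[OF neighbour_sum_zero_iff]) blast
  then have alt: "(- 1 :: real) ^ p i = (- 1) ^ i * (- 1) ^ p 0" if "i < n" for i
    using that by blast
  \<comment> \<open>Whether \<open>p\<close> keeps or flips parity depends only on
    \<open>p 0\<close>, so the effect cancels in a sum of two vertices.\<close>
  have "even (p i) \<longleftrightarrow> (even i \<longleftrightarrow> even (p 0))" if "i < n" for i
    using alt[OF that] by (auto simp: minus_one_power_iff split: if_splits)
  from this[OF uv(1)] this[OF uv(2)] show ?thesis unfolding even_add by blast
qed

section \<open>Edge orbits\<close>

text \<open>Classifying edges by parity instead of by shift gives invariance directly from
  \<open>automorphism_parity\<close>; \<open>parity_edges_forward\<close> recovers the
  shift.\<close>

definition parity_edges :: "bool \<Rightarrow> nat set set" where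
  "parity_edges b = {{u, v} | u v. (u, v) \<in> parcs \<Gamma> \<and> even (u + v) = b}"

lemma edges_\<Gamma>: "edges \<Gamma> = parity_edges True \<union> parity_edges False"
proof (intro equalityI subsetI)
  fix e assume "e \<in> edges \<Gamma>"
  then obtain u v where "e = {u, v}" "(u, v) \<in> parcs \<Gamma>" by (auto simp: edges_def)
  then show "e \<in> parity_edges True \<union> parity_edges False"
    unfolding parity_edges_def by (cases "even (u + v)") blast+
next
  fix e assume "e \<in> parity_edges True \<union> parity_edges False"
  then obtain u v where "e = {u, v}" "(u, v) \<in> parcs \<Gamma>"
    unfolding parity_edges_def by blast
  then show "e \<in> edges \<Gamma>" by (force simp: edges_def)
qed

text \<open>For even \<open>n\<close>, the parity of \<open>u + v\<close> is that of the shift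
  joining the two ends. As \<open>k\<close> and \<open>k + 1\<close> have opposite parities, the
  class determines the shift, and naming the right end first makes it a forward shift.\<close>

lemma parity_edges_forward:
  assumes "e \<in> parity_edges b"
  obtains u where "u < n" "e = {u, (u + (if even k = b then k else k + 1)) mod n}"
proof -
  obtain u v where e: "e = {u, v}" "even (u + v) = b" and uv: "(u, v) \<in> parcs \<Gamma>"
    using assms unfolding parity_edges_def by blast
  obtain s where less: "u < n" "v < n"
    and s: "s \<in> {k, k + 1}" "[v = u + s] (mod n) \<or> [u = v + s] (mod n)"
    using uv unfolding parcs_\<Gamma> by blast
  from s(2) have "even s = b"
  proof
    assume "[v = u + s] (mod n)"
    then have "even v = even (u + s)" using even by (metis cong_def dvd_mod_iff)
    with e show ?thesis by auto
  next
    assume "[u = v + s] (mod n)"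
    then have "even u = even (v + s)" using even by (metis cong_def dvd_mod_iff)
    with e show ?thesis by auto
  qed
  with s have "s = (if even k = b then k else k + 1)" by auto
  moreover from s(2) less have "v = (u + s) mod n \<or> u = (v + s) mod n"
    by (auto simp: cong_def)
  ultimately show ?thesis using that[of u] that[of v] less e(1) by (auto simp: insert_commute)
qed

text \<open>Parity invariance keeps the orbit inside the class. Conversely, all edges of the class
  have the same forward shift, so the rotation matching their starting vertices carries one edge to
  the other.\<close>

lemma orbit_parity_edges:
  assumes e: "e \<in> parity_edges b"
  shows "orbit (automorphism_group \<Gamma>) (\<lambda>p e. p ` e) e = parity_edges b"
proof (intro equalityI subsetI)
  fix f assume "f \<in> orbit (automorphism_group \<Gamma>) (\<lambda>p e. p ` e) e"
  then obtain p where p: "p \<in> carrier (automorphism_group \<Gamma>)" "f = p ` e"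
    by (auto simp: orbit_def)
  obtain u v where uv: "e = {u, v}" "(u, v) \<in> parcs \<Gamma>" "even (u + v) = b"
    using e by (auto simp: parity_edges_def)
  then have "u < n" "v < n" by (simp_all add: parcs_\<Gamma>)
  then have "even (p u + p v) = b" "(p u, p v) \<in> parcs \<Gamma>"
    using automorphism_parity[OF p(1)] p(1) uv
    by (simp_all add: automorphism_group_def pverts_\<Gamma>)
  then show "f \<in> parity_edges b" using p(2) uv(1) by (auto simp: parity_edges_def)
next
  fix f assume "f \<in> parity_edges b"
  let ?s = "if even k = b then k else k + 1"
  obtain u where u: "u < n" "e = {u, (u + ?s) mod n}"
    using parity_edges_forward[OF e] .
  obtain v where v: "v < n" "f = {v, (v + ?s) mod n}"
    using parity_edges_forward[OF \<open>f \<in> parity_edges b\<close>] .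
  let ?t = "v + n - u"
  have "rotation ?t u = v" using u v by (simp add: rotation_def)
  moreover have "rotation ?t ((u + s) mod n) = (v + s) mod n" for s
  proof -
    have "rotation ?t ((u + s) mod n) = (u + s + ?t) mod n"
      using k by (simp add: rotation_def mod_add_left_eq)
    also have "u + s + ?t = v + s + n" using u by simp
    finally show ?thesis by simp
  qed
  ultimately have "f = rotation ?t ` e" unfolding u v by (simp only: image_insert image_empty)
  then show "f \<in> orbit (automorphism_group \<Gamma>) (\<lambda>p e. p ` e) e"
    unfolding orbit_def
    by (intro CollectI exI[of _ "rotation ?t"] conjI rotation_automorphism)
qed

lemma parity_edges_nonempty: "parity_edges b \<noteq> {}"
proof -
  have "(0, s) \<in> parcs \<Gamma>" if "s \<in> {k, k + 1}" for s
    using that k by (auto simp: parcs_\<Gamma> cong_def)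
  then have "{0, if even k = b then k else k + 1} \<in> parity_edges b"
    unfolding parity_edges_def by (intro CollectI exI[of _ 0] exI conjI) (rule refl, auto)
  then show ?thesis by blast
qed

lemma parity_edges_disjoint: "parity_edges True \<inter> parity_edges False = {}"
  by (auto simp: parity_edges_def doubleton_eq_iff)

lemma num_edge_orbits_\<Gamma>: "num_edge_orbits \<Gamma> = 2"
proof -
  have "(\<lambda>e. orbit (automorphism_group \<Gamma>) (\<lambda>p e. p ` e) e) ` parity_edges b = {parity_edges b}"
    for b
    using parity_edges_nonempty[of b] by (auto simp: orbit_parity_edges)
  moreover have "orbits (automorphism_group \<Gamma>) (edges \<Gamma>) (\<lambda>p e. p ` e) =
      (\<lambda>e. orbit (automorphism_group \<Gamma>) (\<lambda>p e. p ` e) e) ` edges \<Gamma>"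
    by (auto simp: orbits_def)
  ultimately have "orbits (automorphism_group \<Gamma>) (edges \<Gamma>) (\<lambda>p e. p ` e) =
      {parity_edges True, parity_edges False}"
    by (simp add: edges_\<Gamma> image_Un insert_commute)
  moreover have "parity_edges True \<noteq> parity_edges False"
    using parity_edges_disjoint parity_edges_nonempty by blast
  ultimately show ?thesis by (simp add: num_edge_orbits_def)
qed

end

section \<open>Choice of the shift for a given order\<close>

theorem theorem10:
  fixes n :: nat
  assumes "even n" and "n \<ge> 8"
  shows "\<exists>G :: nat pair_pre_digraph.
    nut_graph G \<and> card (pverts G) = n \<and> num_vertex_orbits G = 1 \<and> num_edge_orbits G = 2"
proof -
  define k where "k = n div 4 - 1"
  have k: "k \<ge> 1" "2 * k + 2 < n" using assms by (auto simp: k_def)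
  have "n div 4 = k + 1" using k(1) by (simp add: k_def)
  \<comment> \<open>The two residues of an even \<open>n\<close> modulo 4. In either case a common
    divisor of \<open>2 * k + 1\<close> and \<open>n\<close> divides 2 or 4, and it is odd as a
    divisor of \<open>2 * k + 1\<close>, hence a unit.\<close>
  with assms(1) have n: "n = 2 * (2 * k + 1) + 2 \<or> n = 2 * (2 * k + 1) + 4"
    by presburger
  have "coprime (2 * k + 1) n"
  proof (rule coprimeI)
    fix d assume d: "d dvd 2 * k + 1" "d dvd n"
    from n have "n - 2 * (2 * k + 1) = 2 \<or> n - 2 * (2 * k + 1) = 4" by auto
    moreover have "d dvd n - 2 * (2 * k + 1)" using d by (intro dvd_diff_nat dvd_mult)
    ultimately have "d dvd 2 ^ 2" by (auto intro: dvd_trans[of d 2 4])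
    moreover have "coprime d (2 ^ 2)"
    proof -
      have "odd d" using d(1) by (metis dvd_trans dvd_triv_left even_plus_one_iff)
      then show ?thesis by (simp only: coprime_power_right_iff coprime_right_2_iff_odd) blast
    qed
    ultimately show "is_unit d" by (metis coprime_common_divisor dvd_refl)
  qed
  note \<Gamma> = \<open>even n\<close> k this
  show ?thesis
  proof (intro exI conjI)
    show "nut_graph (consecutive_circulant n k)" by (rule nut_graph_\<Gamma>[OF \<Gamma>])
    show "card (pverts (consecutive_circulant n k)) = n"
      by (simp add: consecutive_circulant_def)
    show "num_vertex_orbits (consecutive_circulant n k) = 1"
      by (rule num_vertex_orbits_\<Gamma>[OF \<Gamma>])
    show "num_edge_orbits (consecutive_circulant n k) = 2"
      by (rule num_edge_orbits_\<Gamma>[OF \<Gamma>])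
  qed
qed

end
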